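(* Let $a$, $b$ and $n>1$ be positive integers, let $i\in\{1,\ldots,n\}$, and let $I_2(Y)$ be the ideal of $\Bbbk[x_1,\ldots,x_n]$ generated by the $2\times 2$-minors of $$Y := \left(\begin{array}{cccc} x_1^b & x_2^b & \ldots & x_{n-1}^b \\ x_2 & x_3 & \ldots & x_n \end{array}\right).$$ Let $\mathcal{G}_Y^{(i)} = \mathcal{G}^{(i)}_1 \cup \mathcal{G}^{(i)}_2 \cup \mathcal{G}^{(i)}_3$, where $$\mathcal{G}^{(i)}_1 = \left\{ x_{j+1} x_k^b - x_j^b x_{k+1} \ \mid\ j \in \{i, \ldots, n-2\},\ k \in \{j+1,\ldots, n-1\}\right\},$$ $$\mathcal{G}^{(i)}_2 = \left\{ x_{j+1} x_k^b - x_j^b x_{k+1} \ \mid\ j \in \{1, \ldots, i-2\},\ k \in \{j+1,\ldots, i-1\}\right\},$$ $$\mathcal{G}^{(i)}_3 = \left\{ x_j^b x_{k+1} - x_{j+1} x_k^b \ \mid\ j \in \{1, \ldots, i-1\},\ k \in \{i,\ldots, n-1\}\right\}.$$ Then the set $\mathcal{G}_Y^{(i)}$ is the reduced Gröbner basis of $I_2(Y)$ with respect to the term order $\prec_i$ described in the context. In particular, the cardinality of $\mathcal{G}_Y^{(i)}$ is $\binom{n-1}{2}$.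
   Context: $\Bbbk$ is a field. For a positive integer $b$ and $\ell\ge 1$, $r_b(\ell) := \sum_{j=0}^{\ell-1} b^j$, and $r_b(0):=0$. Set $a_i := r_b(n) + a\, r_b(i-1)$ for $i=1,\ldots,n$, and $\mathcal{A}=\{a_1,\ldots,a_n\}$. The term order $\prec_i$ is the $\mathcal{A}$-graded reverse lexicographical term order on $\Bbbk[x_1,\ldots,x_n]$ induced by $x_i \prec_i x_{i-1} \prec_i \cdots \prec_i x_1 \prec_i x_n \prec_i x_{n-1}\prec_i \cdots \prec_i x_{i+1}$. Explicitly, for distinct monomials $\mathbf{x}^{\mathbf{u}}$ and $\mathbf{x}^{\mathbf{v}}$, one has $\mathbf{x}^{\mathbf{u}} \prec_i \mathbf{x}^{\mathbf{v}}$ if and only if either $\sum_j a_j u_j < \sum_j a_j v_j$, or $\sum_j a_j u_j = \sum_j a_j v_j$ and, for the first index $m$ in the list $i, i-1, \ldots, 1, n, n-1, \ldots, i+1$ with $u_m \ne v_m$, one has $u_m > v_m$. Index sets such as $\{i,\ldots,n-2\}$ are empty when the lower bound exceeds the upper bound.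
   Formalization: For b=1 the set need not be reduced (e.g. n=5, i=1: x_2x_4 leads x_2x_4-x_1x_5 and occurs in x_3^2-x_2x_4); "reduced" is claimed only if b>1, or n≤4, or n=5 and i is 2 or 4; in all cases the set is shown to be a minimal Gröbner basis with leading coefficients 1. *)

theory Defs
  imports Complex_Main "HOL-Library.Poly_Mapping" "HOL-Algebra.Ideal"
begin

text \<open>
  A monomial is its exponent vector, a finitely supported function from variable indices to
  \<^typ>\<open>nat\<close>; a polynomial is a finitely supported function from monomials to coefficients, with
  the convolution product of \<^theory>\<open>HOL-Library.Poly_Mapping\<close>. The product of monomials is therefore
  the sum of exponent vectors.
\<close>

type_synonym mono = "nat \<Rightarrow>\<^sub>0 nat"
type_synonym 'k mpoly = "mono \<Rightarrow>\<^sub>0 'k"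

definition X :: "nat \<Rightarrow> 'k::field mpoly" where
  "X j = Poly_Mapping.single (Poly_Mapping.single j 1) 1"

definition mono_divides :: "mono \<Rightarrow> mono \<Rightarrow> bool" where
  "mono_divides u v \<longleftrightarrow> (\<forall>j. Poly_Mapping.lookup u j \<le> Poly_Mapping.lookup v j)"

text \<open>The ring of polynomials in the variables of index \<open>1, \<dots>, n\<close> only.\<close>

definition poly_ring :: "nat \<Rightarrow> 'k::field mpoly ring" where
  "poly_ring n =
     \<lparr>carrier = {p. \<forall>u\<in>Poly_Mapping.keys p. Poly_Mapping.keys u \<subseteq> {1..n}},
      mult = (*), one = 1, zero = 0, add = (+)\<rparr>"


subsection \<open>Groebner bases\<close>

text \<open>
  A term order is given by its strict part \<open>lt\<close>. The leading monomial, and hence the leading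
  coefficient and the leading term, is meaningful for nonzero polynomials only.
\<close>

definition lead_mono :: "(mono \<Rightarrow> mono \<Rightarrow> bool) \<Rightarrow> 'k::field mpoly \<Rightarrow> mono" where
  "lead_mono lt p =
     (THE u. u \<in> Poly_Mapping.keys p \<and> (\<forall>v\<in>Poly_Mapping.keys p. v \<noteq> u \<longrightarrow> lt v u))"

definition lead_coef :: "(mono \<Rightarrow> mono \<Rightarrow> bool) \<Rightarrow> 'k::field mpoly \<Rightarrow> 'k" where
  "lead_coef lt p = Poly_Mapping.lookup p (lead_mono lt p)"

definition lead_term :: "(mono \<Rightarrow> mono \<Rightarrow> bool) \<Rightarrow> 'k::field mpoly \<Rightarrow> 'k mpoly" where
  "lead_term lt p = Poly_Mapping.single (lead_mono lt p) (lead_coef lt p)"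

definition initial_ideal ::
  "nat \<Rightarrow> (mono \<Rightarrow> mono \<Rightarrow> bool) \<Rightarrow> 'k::field mpoly set \<Rightarrow> 'k mpoly set" where
  "initial_ideal n lt F = Idl\<^bsub>poly_ring n\<^esub> (lead_term lt ` (F - {0}))"

definition groebner_basis ::
  "nat \<Rightarrow> (mono \<Rightarrow> mono \<Rightarrow> bool) \<Rightarrow> 'k::field mpoly set \<Rightarrow> 'k mpoly set \<Rightarrow> bool" where
  "groebner_basis n lt I G \<longleftrightarrow>
     finite G \<and> G \<subseteq> I \<and> initial_ideal n lt G = initial_ideal n lt I"

definition minimal_groebner_basis ::
  "nat \<Rightarrow> (mono \<Rightarrow> mono \<Rightarrow> bool) \<Rightarrow> 'k::field mpoly set \<Rightarrow> 'k mpoly set \<Rightarrow> bool" where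
  "minimal_groebner_basis n lt I G \<longleftrightarrow>
     groebner_basis n lt I G \<and> 0 \<notin> G \<and>
     (\<forall>g\<in>G. lead_coef lt g = 1) \<and>
     (\<forall>g\<in>G. \<forall>h\<in>G. g \<noteq> h \<longrightarrow> \<not> mono_divides (lead_mono lt g) (lead_mono lt h))"

definition reduced_groebner_basis ::
  "nat \<Rightarrow> (mono \<Rightarrow> mono \<Rightarrow> bool) \<Rightarrow> 'k::field mpoly set \<Rightarrow> 'k mpoly set \<Rightarrow> bool" where
  "reduced_groebner_basis n lt I G \<longleftrightarrow>
     groebner_basis n lt I G \<and> 0 \<notin> G \<and>
     (\<forall>g\<in>G. lead_coef lt g = 1) \<and>
     (\<forall>g\<in>G. \<forall>h\<in>G. g \<noteq> h \<longrightarrow> (\<forall>u\<in>Poly_Mapping.keys h. \<not> mono_divides (lead_mono lt g) u))"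


subsection \<open>The weights and the term orders\<close>

definition repunit :: "nat \<Rightarrow> nat \<Rightarrow> nat" where
  "repunit b l = (\<Sum>j<l. b ^ j)"

definition wt :: "nat \<Rightarrow> nat \<Rightarrow> nat \<Rightarrow> nat \<Rightarrow> nat" where
  "wt a b n j = repunit b n + a * repunit b (j - 1)"

definition wdeg :: "nat \<Rightarrow> nat \<Rightarrow> nat \<Rightarrow> mono \<Rightarrow> nat" where
  "wdeg a b n u = (\<Sum>j=1..n. wt a b n j * Poly_Mapping.lookup u j)"

text \<open>The list \<open>i, i - 1, \<dots>, 1, n, n - 1, \<dots>, i + 1\<close> of variable indices.\<close>

definition var_list :: "nat \<Rightarrow> nat \<Rightarrow> nat list" where
  "var_list n i = rev [1..<i + 1] @ rev [i + 1..<n + 1]"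

definition ord_less :: "nat \<Rightarrow> nat \<Rightarrow> nat \<Rightarrow> nat \<Rightarrow> mono \<Rightarrow> mono \<Rightarrow> bool" where
  "ord_less a b n i u v \<longleftrightarrow>
     wdeg a b n u < wdeg a b n v \<or>
     (wdeg a b n u = wdeg a b n v \<and>
      (\<exists>p < length (var_list n i).
         (\<forall>q < p. Poly_Mapping.lookup u (var_list n i ! q) = Poly_Mapping.lookup v (var_list n i ! q)) \<and>
         Poly_Mapping.lookup u (var_list n i ! p) > Poly_Mapping.lookup v (var_list n i ! p)))"


subsection \<open>The determinantal ideal and the candidate basis\<close>

text \<open>Entry of \<open>Y\<close> in row \<open>s\<close> (1 or 2) and column \<open>c\<close> (from 1 to \<open>n - 1\<close>).\<close>

definition Y :: "nat \<Rightarrow> nat \<Rightarrow> nat \<Rightarrow> 'k::field mpoly" where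
  "Y b s c = (if s = 1 then X c ^ b else X (c + 1))"

definition minors2 :: "(nat \<Rightarrow> nat \<Rightarrow> 'k::field mpoly) \<Rightarrow> nat \<Rightarrow> 'k mpoly set" where
  "minors2 M m = {M 1 j * M 2 k - M 1 k * M 2 j | j k. 1 \<le> j \<and> j < k \<and> k \<le> m}"

definition I2Y :: "nat \<Rightarrow> nat \<Rightarrow> 'k::field mpoly set" where
  "I2Y b n = Idl\<^bsub>poly_ring n\<^esub> (minors2 (Y b) (n - 1))"

text \<open>
  Upper bounds such as \<open>n - 2\<close> are truncated at 0, which still gives the empty range since all
  lower bounds are at least 1.
\<close>

definition G1 :: "nat \<Rightarrow> nat \<Rightarrow> nat \<Rightarrow> 'k::field mpoly set" where
  "G1 b n i = {X (j+1) * X k ^ b - X j ^ b * X (k+1) | j k. j \<in> {i..n-2} \<and> k \<in> {j+1..n-1}}"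

definition G2 :: "nat \<Rightarrow> nat \<Rightarrow> 'k::field mpoly set" where
  "G2 b i = {X (j+1) * X k ^ b - X j ^ b * X (k+1) | j k. j \<in> {1..i-2} \<and> k \<in> {j+1..i-1}}"

definition G3 :: "nat \<Rightarrow> nat \<Rightarrow> nat \<Rightarrow> 'k::field mpoly set" where
  "G3 b n i = {X j ^ b * X (k+1) - X (j+1) * X k ^ b | j k. j \<in> {1..i-1} \<and> k \<in> {i..n-1}}"

definition GY :: "nat \<Rightarrow> nat \<Rightarrow> nat \<Rightarrow> 'k::field mpoly set" where
  "GY b n i = G1 b n i \<union> G2 b i \<union> G3 b n i"

text \<open>
  \<open>GY b n i\<close> need not be reduced when \<open>b = 1\<close>: for \<open>n = 5\<close> and \<open>i = 1\<close> it contains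
  \<open>x\<^sub>3\<^sup>2 - x\<^sub>2 x\<^sub>4\<close> and \<open>x\<^sub>2 x\<^sub>4 - x\<^sub>1 x\<^sub>5\<close>, and \<open>x\<^sub>2 x\<^sub>4\<close> is the leading monomial of the latter.
  For \<open>b = 1\<close> such a pair is absent exactly when \<open>n \<le> 4\<close>, or \<open>n = 5\<close> and \<open>i\<close> is 2 or 4; for \<open>b > 1\<close>
  it is always absent.
\<close>

end

theory Submission
  imports Defs
begin

text \<open>
  Give the monomial with exponents \<open>u\<close> the bidegree \<open>(\<Sum>\<^sub>j u\<^sub>j, \<Sum>\<^sub>j u\<^sub>j r\<^sub>b(j-1))\<close>. Both terms of each
  minor have the same bidegree, so \<open>I\<^sub>2(Y)\<close> lies in the toric ideal of the bidegree: for every member of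
  \<open>I\<^sub>2(Y)\<close> the coefficients on each bidegree fibre sum to zero (\<open>fibre_sum_I2Y\<close>). The leading terms of
  the candidate basis are read off from the smallest variable that occurs (\<open>trail_less_lead\<close>). Call a
  monomial standard if none of these leading terms divides it.

  The heart of the matter is that standard monomials of the same bidegree are equal
  (\<open>standard_unique\<close>). Granting this, no S-polynomial is needed. If the leading monomial \<open>u\<close> of some
  nonzero \<open>f \<in> I\<^sub>2(Y)\<close> were standard, then \<open>f\<close> would contain another, hence smaller, monomial in the fibre
  of \<open>u\<close>. But the smallest monomial of a fibre is standard, since otherwise exchanging a leading term for
  the trailing one would make it smaller while preserving the bidegree. So \<open>u\<close> would itself be the
  smallest monomial of its fibre, a contradiction (\<open>lead_mono_I2Y_divisible\<close>).

  Uniqueness of standard monomials is a statement about numeration systems with repunits as place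
  values. The leading terms \<open>x\<^sub>p x\<^sub>k\<^sup>b\<close> on one side of \<open>x\<^sub>i\<close> say that the exponents there are the digits of
  a greedy expansion, and such expansions are unique (\<open>skew_digits_unique\<close>). The leading terms \<open>x\<^sub>j\<^sup>b x\<^sub>q\<close>
  with \<open>j < i < q\<close> say that the exponents below \<open>i\<close> are smaller than \<open>b\<close> if any variable above \<open>i\<close>
  occurs. Relative to \<open>x\<^sub>i\<close>, the variables above \<open>i\<close> have an excess of weight divisible by \<open>b\<^bsup>i-1\<^esup>\<close>, while
  digits smaller than \<open>b\<close> below \<open>i\<close> give the least possible deficit in its residue class modulo
  \<open>b\<^bsup>i-1\<^esup>\<close> (\<open>bounded_digits_minimal\<close>). This separates the two sides.

  Minimality, reducedness and the cardinality are easier, because every term that occurs in the basis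
  has degree \<open>b + 1\<close>: divisibility between two such terms is equality, and it remains to see which of
  the monomials \<open>x\<^bsub>j+1\<^esub> x\<^sub>k\<^sup>b\<close> and \<open>x\<^sub>j\<^sup>b x\<^bsub>k+1\<^esub>\<close> coincide (\<open>lead_exp_inject\<close>, \<open>lead_exp_neq_trail_exp\<close>).
\<close>

section \<open>Expansions in repunits\<close>

lemma repunit_0 [simp]: "repunit b 0 = 0"
  by (simp add: repunit_def)

lemma repunit_Suc: "repunit b (Suc l) = 1 + b * repunit b l"
  unfolding repunit_def by (simp only: sum.lessThan_Suc_shift) (simp add: sum_distrib_left)

lemma repunit_add: "repunit b (l + m) = repunit b l + b ^ l * repunit b m"
  by (induction l) (simp_all add: repunit_Suc algebra_simps)

lemma repunit_mono: "k \<le> l \<Longrightarrow> repunit b k \<le> repunit b l"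
  using repunit_add[of b k "l - k"] by simp

text \<open>
  The digit strings produced by the greedy expansion of a number in the basis
  \<open>r\<^sub>b(1), \<dots>, r\<^sub>b(m)\<close>. Since \<open>b r\<^sub>b(k) = r\<^sub>b(k+1) - 1\<close>, a digit below the top may be as large as \<open>b\<close>,
  but only when all digits of smaller index vanish. The top digit, of index \<open>m\<close>, is unrestricted because no larger
  repunit is available to absorb it.
\<close>

definition skew_digits :: "nat \<Rightarrow> nat \<Rightarrow> (nat \<Rightarrow> nat) \<Rightarrow> bool" where
  "skew_digits b m c \<longleftrightarrow> (\<forall>k\<in>{1..<m}. c k \<le> b \<and> (c k = b \<longrightarrow> (\<forall>p\<in>{1..<k}. c p = 0)))"

lemma skew_digits_mono: "skew_digits b m c \<Longrightarrow> l \<le> m \<Longrightarrow> skew_digits b l c"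
  unfolding skew_digits_def by (meson atLeastLessThan_iff order_less_le_trans)

lemma skew_digits_Suc:
  "1 \<le> m \<Longrightarrow> skew_digits b (Suc m) c \<longleftrightarrow>
    skew_digits b m c \<and> c m \<le> b \<and> (c m = b \<longrightarrow> (\<forall>p\<in>{1..<m}. c p = 0))"
  by (auto simp: skew_digits_def atLeastLessThanSuc)

text \<open>
  For \<open>m \<ge> 2\<close> the extreme string has a single nonzero digit, \<open>b\<close> in position \<open>m - 1\<close>, and its value is
  exactly \<open>r\<^sub>b(m) - 1\<close>.
\<close>

lemma skew_sum_less:
  assumes "1 \<le> m" "skew_digits b m c"
  shows "(\<Sum>k=1..<m. c k * repunit b k) < repunit b m"
  using assms
proof (induction m rule: nat_induct_at_least)
  case base
  then show ?case by (simp add: repunit_Suc)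
next
  case (Suc m)
  have sk: "skew_digits b m c" "c m \<le> b" "c m = b \<Longrightarrow> \<forall>p\<in>{1..<m}. c p = 0"
    using Suc.prems Suc.hyps by (simp_all add: skew_digits_Suc)
  show ?case
  proof (cases "c m = b")
    case True
    then show ?thesis using sk(3) Suc.hyps by (simp add: repunit_Suc)
  next
    case False
    have "(\<Sum>k=1..<Suc m. c k * repunit b k) < repunit b m + c m * repunit b m"
      using Suc.IH[OF sk(1)] Suc.hyps by simp
    also have "\<dots> = Suc (c m) * repunit b m" by simp
    also have "\<dots> \<le> b * repunit b m"
      using sk(2) False by (intro mult_le_mono1) simp
    finally show ?thesis by (simp add: repunit_Suc)
  qed
qed

text \<open>
  The lower digits contribute less than \<open>r\<^sub>b(m)\<close>, so the top digit is the quotient of the value by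
  \<open>r\<^sub>b(m)\<close>; the remainder then determines the next digit in the same way.
\<close>

lemma skew_digits_unique:
  assumes "skew_digits b m c" "skew_digits b m d"
    and "(\<Sum>k=1..m. c k * repunit b k) = (\<Sum>k=1..m. d k * repunit b k)"
  shows "\<forall>k\<in>{1..m}. c k = d k"
  using assms
proof (induction m)
  case 0
  then show ?case by simp
next
  case (Suc m)
  let ?s = "\<lambda>c. \<Sum>k=1..m. c k * repunit b k"
  have sk: "skew_digits b m c" "skew_digits b m d"
    using Suc.prems(1,2) by (simp_all add: skew_digits_mono[where m = "Suc m"])
  have less: "?s c < repunit b (Suc m)" "?s d < repunit b (Suc m)"
    using skew_sum_less[OF _ Suc.prems(1)] skew_sum_less[OF _ Suc.prems(2)]
    by (simp_all add: atLeastLessThanSuc_atLeastAtMost)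
  have eq: "?s c + c (Suc m) * repunit b (Suc m) = ?s d + d (Suc m) * repunit b (Suc m)"
    using Suc.prems(3) by simp
  have "c (Suc m) = d (Suc m)"
    using arg_cong[OF eq, of "\<lambda>x. x div repunit b (Suc m)"] less by simp
  moreover from this have "\<forall>k\<in>{1..m}. c k = d k"
    using Suc.IH[OF sk] eq by simp
  ultimately show ?case by (simp add: atLeastAtMostSuc_conv)
qed

text \<open>
  Here the weights are \<open>r\<^sub>b(m) - r\<^sub>b(j) = b\<^sup>j + \<dots> + b\<^bsup>m-1\<^esup>\<close>. Trading \<open>b\<close> copies of the weight at
  position \<open>j\<close> for one copy of the weight at position \<open>j + 1\<close> (weight 0 when \<open>j + 1 = m\<close>) lowers the
  value by exactly \<open>b\<^sup>m\<close>. Carrying in this way turns any digits \<open>c\<close> into digits below \<open>b\<close>, and digits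
  below \<open>b\<close> are determined by their value modulo \<open>b\<^sup>m\<close>. So \<open>d\<close> has the least value in its residue
  class and attains it alone.

  The induction strips position 0: all the other weights are divisible by \<open>b\<close> and the weight at 0 is 1
  modulo \<open>b\<close>, so \<open>c 0\<close> and \<open>d 0\<close> agree modulo \<open>b\<close>. The quotient \<open>k\<close> is carried to the next position.
\<close>

lemma bounded_digits_minimal:
  assumes "\<forall>j<m. d j < b"
    and "(\<Sum>j<m. c j * (repunit b m - repunit b j)) + b ^ m * s
       = (\<Sum>j<m. d j * (repunit b m - repunit b j))"
  shows "s = 0 \<and> (\<forall>j<m. c j = d j)"
  using assms
proof (induction m arbitrary: c d s)
  case 0
  then show ?case by simp
next
  case (Suc m)
  define T where "T l c = (\<Sum>j<l. c j * (repunit b l - repunit b j))" for l and c :: "nat \<Rightarrow> nat"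
  have T_Suc: "T (Suc m) c = c 0 * repunit b (Suc m) + b * T m (\<lambda>j. c (Suc j))" for c
    unfolding T_def sum.lessThan_Suc_shift
    by (simp add: repunit_Suc sum_distrib_left diff_mult_distrib2 mult.left_commute)
  have T_mod: "T (Suc m) c = c 0 + b * (c 0 * repunit b m + T m (\<lambda>j. c (Suc j)))" for c
    by (simp add: T_Suc repunit_Suc algebra_simps)
  have eq: "T (Suc m) c + b ^ Suc m * s = T (Suc m) d"
    using Suc.prems(2) by (simp add: T_def)
  have d0: "d 0 < b" using Suc.prems(1) by simp
  have "(T (Suc m) c + b ^ Suc m * s) mod b = c 0 mod b"
  proof -
    have "T (Suc m) c + b ^ Suc m * s = c 0 + b * (c 0 * repunit b m + T m (\<lambda>j. c (Suc j)) + b ^ m * s)"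
      unfolding T_mod by (simp add: algebra_simps)
    then show ?thesis by simp
  qed
  moreover have "T (Suc m) d mod b = d 0" unfolding T_mod using d0 by simp
  ultimately have "d 0 = c 0 mod b" using eq by simp
  then obtain k where k: "c 0 = d 0 + b * k"
    by (metis add.commute mult_div_mod_eq)
  \<comment> \<open>The digits after carrying \<open>k\<close> out of position 0 and dropping that position.\<close>
  let ?c = "(\<lambda>j. c (Suc j))(0 := c (Suc 0) + k)"
  have shift: "T m ?c = T m (\<lambda>j. c (Suc j)) + k * repunit b m"
  proof (cases m)
    case 0
    then show ?thesis by (simp add: T_def)
  next
    case (Suc l)
    then show ?thesis unfolding T_def by (simp only: sum.lessThan_Suc_shift) (simp add: algebra_simps)
  qed
  have rm: "repunit b (Suc m) = repunit b m + b ^ m"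
    using repunit_add[of b m 1] by (simp add: repunit_Suc)
  have "b * (T m ?c + b ^ m * (s + k)) = b * T m (\<lambda>j. d (Suc j))"
    using eq unfolding T_Suc k shift rm by (simp add: algebra_simps)
  then have "T m ?c + b ^ m * (s + k) = T m (\<lambda>j. d (Suc j))" using d0 by simp
  moreover have "\<forall>j<m. d (Suc j) < b" using Suc.prems(1) by simp
  ultimately have "s + k = 0 \<and> (\<forall>j<m. ?c j = d (Suc j))"
    unfolding T_def by (intro Suc.IH)
  then have IH: "s + k = 0" "\<forall>j<m. ?c j = d (Suc j)" by blast+
  have "c (Suc j) = d (Suc j)" if "j < m" for j
    using IH that by (cases j) auto
  with IH(1) k show ?case by (auto simp: less_Suc_eq_0_disj)
qed

abbreviation expo :: "mono \<Rightarrow> nat \<Rightarrow> nat" where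
  "expo \<equiv> Poly_Mapping.lookup"

section \<open>Monomials and their bidegree\<close>

text \<open>
  The two components of the bidegree of a monomial. Both terms of every minor of the matrix have the
  same bidegree, and the weighted degree of the term order is a function of it.
\<close>

definition mdeg :: "nat \<Rightarrow> mono \<Rightarrow> nat" where
  "mdeg n u = (\<Sum>j=1..n. expo u j)"

definition mwt :: "nat \<Rightarrow> nat \<Rightarrow> mono \<Rightarrow> nat" where
  "mwt b n u = (\<Sum>j=1..n. expo u j * repunit b (j - 1))"

lemma mdeg_add: "mdeg n (u + v) = mdeg n u + mdeg n v"
  by (simp add: mdeg_def lookup_add sum.distrib)

lemma mwt_add: "mwt b n (u + v) = mwt b n u + mwt b n v"
  by (simp add: mwt_def lookup_add sum.distrib algebra_simps)

lemma wdeg_add: "wdeg a b n (u + v) = wdeg a b n u + wdeg a b n v"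
  by (simp add: wdeg_def lookup_add sum.distrib algebra_simps)

lemma wdeg_eq_bidegree: "wdeg a b n u = repunit b n * mdeg n u + a * mwt b n u"
  by (simp add: wdeg_def wt_def mdeg_def mwt_def sum_distrib_left sum.distrib algebra_simps)

lemma mdeg_single: "j \<in> {1..n} \<Longrightarrow> mdeg n (Poly_Mapping.single j c) = c"
  by (simp add: mdeg_def lookup_single when_def)

lemma mwt_single: "j \<in> {1..n} \<Longrightarrow> mwt b n (Poly_Mapping.single j c) = c * repunit b (j - 1)"
proof -
  assume j: "j \<in> {1..n}"
  have "mwt b n (Poly_Mapping.single j c) = (\<Sum>l=1..n. if l = j then c * repunit b (j - 1) else 0)"
    unfolding mwt_def by (intro sum.cong) (auto simp: lookup_single when_def)
  then show ?thesis using j by simp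
qed

text \<open>
  Between monomials of equal degree, divisibility leaves no room for a proper cofactor.
\<close>

lemma mono_divides_same_mdeg:
  assumes "mono_divides u v" "mdeg n u = mdeg n v"
    "Poly_Mapping.keys u \<subseteq> {1..n}" "Poly_Mapping.keys v \<subseteq> {1..n}"
  shows "u = v"
proof (rule poly_mapping_eqI)
  fix j
  show "expo u j = expo v j"
  proof (cases "j \<in> {1..n}")
    case True
    show ?thesis
    proof (rule ccontr)
      assume "expo u j \<noteq> expo v j"
      then have "mdeg n u < mdeg n v"
        unfolding mdeg_def using assms(1) True
        by (intro sum_strict_mono_ex1 bexI[of _ j]) (auto simp: mono_divides_def le_neq_implies_less)
      then show False using assms(2) by simp
    qed
  next
    case False
    then show ?thesis using assms(3,4) by (metis in_keys_iff subsetD)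
  qed
qed

text \<open>
  This replaces well-foundedness of the term order: only minima of single bidegree fibres are needed,
  and each fibre is contained in such a finite set.
\<close>

lemma finite_bounded_monomials: "finite {u::mono. Poly_Mapping.keys u \<subseteq> {1..n} \<and> mdeg n u = d}"
proof -
  have "expo u j \<le> d" if "mdeg n u = d" "j \<in> {1..n}" for u j
    using member_le_sum[of j "{1..n}" "expo u"] that by (simp add: mdeg_def)
  then have "expo ` {u. Poly_Mapping.keys u \<subseteq> {1..n} \<and> mdeg n u = d}
    \<subseteq> {f. \<forall>j. (j \<in> {1..n} \<longrightarrow> f j \<in> {..d}) \<and> (j \<notin> {1..n} \<longrightarrow> f j = 0)}"
    by (auto simp: in_keys_iff subset_iff)
  then have "finite (expo ` {u. Poly_Mapping.keys u \<subseteq> {1..n} \<and> mdeg n u = d})"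
    by (rule finite_subset) (intro finite_set_of_finite_funs, simp_all)
  then show ?thesis
    by (rule finite_imageD) (intro inj_onI, simp add: poly_mapping_eqI)
qed

section \<open>The term order\<close>

lemma length_var_list: "i \<le> n \<Longrightarrow> length (var_list n i) = n"
  by (simp add: var_list_def del: upt_Suc)

lemma nth_var_list:
  assumes "i \<le> n" "p < n"
  shows "var_list n i ! p = (if p < i then i - p else n + i - p)"
  using assms by (auto simp: var_list_def nth_append rev_nth simp del: upt_Suc)

lemma set_var_list: "i \<le> n \<Longrightarrow> set (var_list n i) = {1..n}"
  by (auto simp: var_list_def)

text \<open>
  The condition on \<open>q\<close> says that \<open>q\<close> precedes \<open>m\<close> in the list \<open>i, \<dots>, 1, n, \<dots>, i+1\<close>.
\<close>

lemma ord_lessI: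
  assumes "i \<le> n" "m \<in> {1..n}" "wdeg a b n u = wdeg a b n v" "expo v m < expo u m"
    and "\<And>q. q \<in> {1..n} \<Longrightarrow> (if m \<le> i then m < q \<and> q \<le> i else q \<le> i \<or> m < q) \<Longrightarrow> expo u q = expo v q"
  shows "ord_less a b n i u v"
proof -
  \<comment> \<open>The position of \<open>m\<close> in the list of variables.\<close>
  define p where "p = (if m \<le> i then i - m else n + i - m)"
  have p: "p < n" "var_list n i ! p = m"
    using assms(1,2) by (auto simp: p_def nth_var_list)
  have "expo u (var_list n i ! q) = expo v (var_list n i ! q)" if "q < p" for q
    using assms(1,2) that p(1) by (intro assms(5)) (auto simp: nth_var_list p_def split: if_splits)
  then show ?thesis
    unfolding ord_less_def using assms(1,3,4) p by (auto simp: length_var_list)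
qed

lemma ord_less_asym: "ord_less a b n i u v \<Longrightarrow> \<not> ord_less a b n i v u"
  unfolding ord_less_def by (metis less_imp_not_less linorder_neqE_nat)

lemma ord_less_trans:
  assumes "ord_less a b n i u v" "ord_less a b n i v w"
  shows "ord_less a b n i u w"
proof (cases "wdeg a b n u = wdeg a b n v \<and> wdeg a b n v = wdeg a b n w")
  case True
  let ?x = "\<lambda>p. var_list n i ! p"
  obtain p where p: "p < length (var_list n i)" "\<forall>q<p. expo u (?x q) = expo v (?x q)"
      "expo v (?x p) < expo u (?x p)"
    using assms(1) True by (auto simp: ord_less_def)
  obtain p' where p': "p' < length (var_list n i)" "\<forall>q<p'. expo v (?x q) = expo w (?x q)"
      "expo w (?x p') < expo v (?x p')"
    using assms(2) True by (auto simp: ord_less_def)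
  have "\<forall>q<min p p'. expo u (?x q) = expo w (?x q)" using p(2) p'(2) by simp
  moreover have "expo w (?x (min p p')) < expo u (?x (min p p'))"
    using p(2,3) p'(2,3) by (cases p p' rule: linorder_cases) auto
  moreover have "min p p' < length (var_list n i)" using p(1) by simp
  ultimately have "\<exists>p<length (var_list n i). (\<forall>q<p. expo u (?x q) = expo w (?x q)) \<and> expo w (?x p) < expo u (?x p)"
    by blast
  then show ?thesis using True unfolding ord_less_def by simp
next
  case False
  then show ?thesis using assms by (auto simp: ord_less_def)
qed

lemma ord_less_total:
  assumes "i \<le> n" "Poly_Mapping.keys u \<subseteq> {1..n}" "Poly_Mapping.keys v \<subseteq> {1..n}" "u \<noteq> v"
  shows "ord_less a b n i u v \<or> ord_less a b n i v u"
proof -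
  obtain j where j: "expo u j \<noteq> expo v j"
    using assms(4) by (metis poly_mapping_eqI)
  then have "j \<in> {1..n}" using assms(2,3) by (metis in_keys_iff subsetD)
  then obtain p where "p < length (var_list n i)" "var_list n i ! p = j"
    using set_var_list[OF assms(1)] by (metis in_set_conv_nth)
  then have ex: "\<exists>p. p < length (var_list n i) \<and> expo u (var_list n i ! p) \<noteq> expo v (var_list n i ! p)"
    using j by blast
  define p where "p = (LEAST p. p < length (var_list n i) \<and> expo u (var_list n i ! p) \<noteq> expo v (var_list n i ! p))"
  have p: "p < length (var_list n i)" "expo u (var_list n i ! p) \<noteq> expo v (var_list n i ! p)"
    using LeastI_ex[OF ex] by (simp_all add: p_def)
  have "\<forall>q<p. expo u (var_list n i ! q) = expo v (var_list n i ! q)"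
    using not_less_Least p(1) unfolding p_def by (metis (mono_tags, lifting) order_less_trans)
  then show ?thesis
    using p unfolding ord_less_def by (metis linorder_neqE_nat)
qed

lemma ord_less_add: "ord_less a b n i u v \<Longrightarrow> ord_less a b n i (w + u) (w + v)"
  by (simp add: ord_less_def wdeg_add lookup_add)

text \<open>
  Stated for an arbitrary relation so that it yields leading monomials (with the converse of the term
  order) as well as minimal elements of fibres.
\<close>

lemma finite_has_least:
  assumes "finite S" "S \<noteq> {}"
    and "\<And>x. \<not> R x x" "\<And>x y z. R x y \<Longrightarrow> R y z \<Longrightarrow> R x z"
    and "\<And>x y. x \<in> S \<Longrightarrow> y \<in> S \<Longrightarrow> x \<noteq> y \<Longrightarrow> R x y \<or> R y x"
  shows "\<exists>x\<in>S. \<forall>y\<in>S. y \<noteq> x \<longrightarrow> R x y"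
  using assms(1,2,5)
proof (induction rule: finite_ne_induct)
  case (singleton x)
  then show ?case by simp
next
  case (insert x F)
  then obtain m where m: "m \<in> F" "\<forall>y\<in>F. y \<noteq> m \<longrightarrow> R m y" by blast
  have "R x m \<or> R m x" using insert.hyps m(1) insert.prems by blast
  then show ?case
  proof
    assume "R x m"
    then have "\<forall>y\<in>F. R x y" using m assms(4) by metis
    then show ?thesis by blast
  next
    assume "R m x"
    then show ?thesis using m by blast
  qed
qed

section \<open>Leading monomials of the minors\<close>

definition pairs :: "nat \<Rightarrow> (nat \<times> nat) set" where
  "pairs n = {(j, k). 1 \<le> j \<and> j < k \<and> k < n}"

text \<open>
  The exponents of \<open>x\<^sub>j\<^sup>b x\<^bsub>k+1\<^esub>\<close> and \<open>x\<^bsub>j+1\<^esub> x\<^sub>k\<^sup>b\<close>, the products of the entries on the diagonal and on the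
  antidiagonal of the submatrix formed by columns \<open>j\<close> and \<open>k\<close>.
\<close>

definition diag_exp :: "nat \<Rightarrow> nat \<Rightarrow> nat \<Rightarrow> mono" where
  "diag_exp b j k = Poly_Mapping.single j b + Poly_Mapping.single (k + 1) 1"

definition anti_exp :: "nat \<Rightarrow> nat \<Rightarrow> nat \<Rightarrow> mono" where
  "anti_exp b j k = Poly_Mapping.single (j + 1) 1 + Poly_Mapping.single k b"

text \<open>
  The diagonal term leads exactly when the pair of columns straddles \<open>i\<close>, that is, when \<open>x\<^sub>j\<close> and
  \<open>x\<^bsub>k+1\<^esub>\<close> lie strictly on opposite sides of \<open>x\<^sub>i\<close>.
\<close>

definition lead_exp :: "nat \<Rightarrow> nat \<Rightarrow> nat \<Rightarrow> nat \<Rightarrow> mono" where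
  "lead_exp b i j k = (if j < i \<and> i \<le> k then diag_exp b j k else anti_exp b j k)"

definition trail_exp :: "nat \<Rightarrow> nat \<Rightarrow> nat \<Rightarrow> nat \<Rightarrow> mono" where
  "trail_exp b i j k = (if j < i \<and> i \<le> k then anti_exp b j k else diag_exp b j k)"

lemma expo_diag_exp:
  "expo (diag_exp b j k) q = (if q = j then b else 0) + (if q = k + 1 then 1 else 0)"
  by (auto simp: diag_exp_def lookup_add lookup_single when_def)

lemma expo_anti_exp:
  "expo (anti_exp b j k) q = (if q = j + 1 then 1 else 0) + (if q = k then b else 0)"
  by (auto simp: anti_exp_def lookup_add lookup_single when_def)

lemma keys_diag_anti_exp:
  assumes "(j, k) \<in> pairs n"
  shows "Poly_Mapping.keys (diag_exp b j k) \<subseteq> {1..n}" "Poly_Mapping.keys (anti_exp b j k) \<subseteq> {1..n}"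
  using assms by (auto simp: in_keys_iff expo_diag_exp expo_anti_exp pairs_def split: if_splits)

text \<open>
  By \<open>r\<^sub>b(l) = 1 + b r\<^sub>b(l-1)\<close>, applied with \<open>l = j\<close> to the diagonal term and with \<open>l = k\<close> to the
  antidiagonal one, both weights come out as \<open>r\<^sub>b(j) + r\<^sub>b(k) - 1\<close>.
\<close>

lemma bidegree_diag_anti_exp:
  assumes "(j, k) \<in> pairs n"
  shows "mdeg n (diag_exp b j k) = b + 1" "mdeg n (anti_exp b j k) = b + 1"
    and "mwt b n (diag_exp b j k) = mwt b n (anti_exp b j k)"
proof -
  have m: "j \<in> {1..n}" "j + 1 \<in> {1..n}" "k \<in> {1..n}" "k + 1 \<in> {1..n}"
    using assms by (auto simp: pairs_def)
  show "mdeg n (diag_exp b j k) = b + 1" "mdeg n (anti_exp b j k) = b + 1"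
    unfolding diag_exp_def anti_exp_def mdeg_add by (simp_all only: mdeg_single m)
  have "repunit b j = 1 + b * repunit b (j - 1)" "repunit b k = 1 + b * repunit b (k - 1)"
    using repunit_Suc[of b "j - 1"] repunit_Suc[of b "k - 1"] assms by (simp_all add: pairs_def)
  then show "mwt b n (diag_exp b j k) = mwt b n (anti_exp b j k)"
    unfolding diag_exp_def anti_exp_def mwt_add using m by (simp add: mwt_single)
qed

lemma bidegree_lead_trail_exp:
  assumes "(j, k) \<in> pairs n"
  shows "mdeg n (lead_exp b i j k) = b + 1" "mdeg n (trail_exp b i j k) = b + 1"
    and "mwt b n (lead_exp b i j k) = mwt b n (trail_exp b i j k)"
  using bidegree_diag_anti_exp[OF assms] by (simp_all add: lead_exp_def trail_exp_def)

lemma keys_lead_trail_exp: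
  assumes "(j, k) \<in> pairs n"
  shows "Poly_Mapping.keys (lead_exp b i j k) \<subseteq> {1..n}" "Poly_Mapping.keys (trail_exp b i j k) \<subseteq> {1..n}"
  using keys_diag_anti_exp[OF assms] by (simp_all add: lead_exp_def trail_exp_def)

text \<open>
  The two terms have the same weighted degree, so the smallest of the variables
  \<open>x\<^sub>j, x\<^bsub>j+1\<^esub>, x\<^sub>k, x\<^bsub>k+1\<^esub>\<close> decides: the term containing it is the smaller one.
\<close>

lemma trail_less_lead:
  assumes "(j, k) \<in> pairs n" "b > 0" "i \<in> {1..n}"
  shows "ord_less a b n i (trail_exp b i j k) (lead_exp b i j k)"
proof -
  have jk: "1 \<le> j" "j < k" "k < n" using assms(1) by (auto simp: pairs_def)
  have w: "wdeg a b n (trail_exp b i j k) = wdeg a b n (lead_exp b i j k)"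
    unfolding wdeg_eq_bidegree using bidegree_lead_trail_exp[OF assms(1)] by simp
  \<comment> \<open>The index of the smallest variable that occurs in the minor.\<close>
  define m where "m = (if j < i \<and> i < k then j + 1 else if j = i \<or> k = i then i else k + 1)"
  show ?thesis
  proof (rule ord_lessI[where m = m])
    show "wdeg a b n (trail_exp b i j k) = wdeg a b n (lead_exp b i j k)" by (fact w)
    show "i \<le> n" "m \<in> {1..n}" using assms(3) jk by (auto simp: m_def)
    show "expo (lead_exp b i j k) m < expo (trail_exp b i j k) m"
      using jk assms(2) by (auto simp: m_def lead_exp_def trail_exp_def expo_diag_exp expo_anti_exp)
    show "expo (trail_exp b i j k) q = expo (lead_exp b i j k) q"
      if "q \<in> {1..n}" "if m \<le> i then m < q \<and> q \<le> i else q \<le> i \<or> m < q" for q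
      using jk that by (auto simp: m_def lead_exp_def trail_exp_def expo_diag_exp expo_anti_exp split: if_splits)
  qed
qed

text \<open>
  The monomials \<open>x\<^sub>p x\<^sub>k\<^sup>b\<close> with \<open>p \<le> k\<close>, and likewise \<open>x\<^sub>j\<^sup>b x\<^sub>q\<close> with \<open>j < q\<close>, determine their indices: the
  larger index is the last variable that occurs.
\<close>

lemma anti_exp_inject:
  assumes "anti_exp b j k = anti_exp b j' k'" "j < k" "j' < k'" "b > 0"
  shows "j = j' \<and> k = k'"
proof -
  have eq: "expo (anti_exp b j k) q = expo (anti_exp b j' k') q" for q
    by (simp only: assms(1))
  have "k' \<le> k" using eq[of k'] assms(2-) by (simp add: expo_anti_exp split: if_splits)
  moreover have "k \<le> k'" using eq[of k] assms(2-) by (simp add: expo_anti_exp split: if_splits)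
  ultimately have k: "k = k'" by simp
  then show ?thesis using eq[of "j + 1"] by (simp add: expo_anti_exp split: if_splits)
qed

lemma diag_exp_inject:
  assumes "diag_exp b j k = diag_exp b j' k'" "j < k" "j' < k'" "b > 0"
  shows "j = j' \<and> k = k'"
proof -
  have eq: "expo (diag_exp b j k) q = expo (diag_exp b j' k') q" for q
    by (simp only: assms(1))
  have "k' \<le> k" using eq[of "k' + 1"] assms(2-) by (simp add: expo_diag_exp split: if_splits)
  moreover have "k \<le> k'" using eq[of "k + 1"] assms(2-) by (simp add: expo_diag_exp split: if_splits)
  ultimately have k: "k = k'" by simp
  then show ?thesis using eq[of j] assms(4) by (simp add: expo_diag_exp split: if_splits)
qed

text \<open>
  The last variable has exponent at least \<open>b\<close> in an antidiagonal term but exponent 1 in a diagonal one,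
  so the two kinds can only meet when \<open>b = 1\<close>, as in \<open>x\<^bsub>j+1\<^esub> x\<^sub>k\<close>.
\<close>

lemma anti_exp_eq_diag_exp:
  assumes "anti_exp b j k = diag_exp b j' k'" "j < k" "j' < k'" "b > 0"
  shows "b = 1 \<and> j' = j + 1 \<and> k = k' + 1"
proof -
  have eq: "expo (anti_exp b j k) q = expo (diag_exp b j' k') q" for q
    by (simp only: assms(1))
  have "k' + 1 \<le> k"
    using eq[of "k' + 1"] assms(2-) by (simp add: expo_anti_exp expo_diag_exp split: if_splits)
  moreover have "k \<le> k' + 1"
    using eq[of k] assms(2-) by (simp add: expo_anti_exp expo_diag_exp split: if_splits)
  ultimately have k: "k = k' + 1" by simp
  have b: "b = 1" "j + 1 \<noteq> k"
    using eq[of k] assms(2-) k by (simp_all add: expo_anti_exp expo_diag_exp split: if_splits)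
  then show ?thesis
    using k eq[of "j + 1"] by (simp add: expo_anti_exp expo_diag_exp split: if_splits)
qed

text \<open>
  A diagonal and an antidiagonal leading term cannot coincide: the former has variables on both sides
  of \<open>x\<^sub>i\<close>, the latter on one side only.
\<close>

lemma lead_exp_inject:
  assumes "lead_exp b i j k = lead_exp b i j' k'" "j < k" "j' < k'" "b > 0"
  shows "j = j' \<and> k = k'"
proof -
  have ne: False if "anti_exp b l m = diag_exp b l' m'" "l < m" "l' < i" "i \<le> m'" "\<not> (l < i \<and> i \<le> m)" for l m l' m'
    using anti_exp_eq_diag_exp[OF that(1,2) _ assms(4)] that by auto
  show ?thesis
    using assms(1) anti_exp_inject[OF _ assms(2-4)] diag_exp_inject[OF _ assms(2-4)]
      ne[of j k j' k'] ne[of j' k' j k] assms(2,3)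
    unfolding lead_exp_def by (auto split: if_splits)
qed

text \<open>
  For \<open>b = 1\<close> the only possible coincidence is \<open>x\<^bsub>j+1\<^esub> x\<^sub>k = x\<^bsub>l\<^esub> x\<^bsub>m+1\<^esub>\<close> with \<open>l = j + 1\<close> and \<open>m = k - 1\<close>,
  where the inner pair has \<open>l < m\<close>. Then \<open>k \<ge> j + 3\<close>, so \<open>n \<ge> 5\<close>, and for \<open>n = 5\<close> the outer pair is
  \<open>(1, 4)\<close> and the inner one \<open>(2, 3)\<close>. If the antidiagonal term of the outer pair leads, then \<open>i \<le> 1\<close> or
  \<open>i \<ge> 5\<close>; if the diagonal term of the inner pair leads, then \<open>i = 3\<close>.
\<close>

lemma lead_exp_neq_trail_exp:
  assumes "(j, k) \<in> pairs n" "(j', k') \<in> pairs n" "b > 0"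
    and "b > 1 \<or> n \<le> 4 \<or> (n = 5 \<and> i \<in> {2, 4})"
  shows "lead_exp b i j k \<noteq> trail_exp b i j' k'"
proof
  assume eq: "lead_exp b i j k = trail_exp b i j' k'"
  have jk: "1 \<le> j" "j < k" "k < n" "1 \<le> j'" "j' < k'" "k' < n"
    using assms(1,2) by (auto simp: pairs_def)
  consider (anti) "anti_exp b j k = diag_exp b j' k'" "i \<le> j \<or> k < i" "i \<le> j' \<or> k' < i"
    | (diag) "anti_exp b j' k' = diag_exp b j k" "j < i" "i \<le> k" "j' < i" "i \<le> k'"
    | (same_anti) "anti_exp b j k = anti_exp b j' k'" "i \<le> j \<or> k < i" "j' < i" "i \<le> k'"
    | (same_diag) "diag_exp b j k = diag_exp b j' k'" "i \<le> j' \<or> k' < i" "j < i" "i \<le> k"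
    using eq by (auto simp: lead_exp_def trail_exp_def not_less not_le split: if_splits)
  then show False
  proof cases
    case anti
    from anti_exp_eq_diag_exp[OF anti(1) jk(2,5) assms(3)] show False using anti(2,3) jk assms(4) by auto
  next
    case diag
    from anti_exp_eq_diag_exp[OF diag(1) jk(5,2) assms(3)] show False using diag(2-) jk assms(4) by auto
  next
    case same_anti
    from anti_exp_inject[OF same_anti(1) jk(2,5) assms(3)] show False using same_anti by auto
  next
    case same_diag
    from diag_exp_inject[OF same_diag(1) jk(2,5) assms(3)] show False using same_diag by auto
  qed
qed

section \<open>Standard monomials\<close>

definition standard :: "nat \<Rightarrow> nat \<Rightarrow> nat \<Rightarrow> mono \<Rightarrow> bool" where
  "standard b n i u \<longleftrightarrow> (\<forall>(j, k)\<in>pairs n. \<not> mono_divides (lead_exp b i j k) u)"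

lemma diag_exp_divides:
  "expo u j \<ge> b \<Longrightarrow> expo u (k + 1) > 0 \<Longrightarrow> j < k \<Longrightarrow> mono_divides (diag_exp b j k) u"
  by (auto simp: mono_divides_def expo_diag_exp)

lemma anti_exp_divides:
  "expo u (j + 1) > 0 \<Longrightarrow> expo u k \<ge> b \<Longrightarrow> j + 1 < k \<Longrightarrow> mono_divides (anti_exp b j k) u"
  "expo u k > b \<Longrightarrow> j + 1 = k \<Longrightarrow> mono_divides (anti_exp b j k) u"
  by (auto simp: mono_divides_def expo_anti_exp)

lemma standard_anti:
  assumes "standard b n i u" "1 \<le> j" "j < k" "k < n" "i \<le> j \<or> k < i"
  shows "\<not> mono_divides (anti_exp b j k) u"
proof -
  have "lead_exp b i j k = anti_exp b j k" using assms(5) by (auto simp: lead_exp_def)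
  then show ?thesis using assms(1-4) by (force simp: standard_def pairs_def)
qed

text \<open>
  A block of consecutive exponents on one side of \<open>i\<close> is a skew digit string precisely because it avoids
  all the monomials \<open>x\<^sub>p x\<^sub>k\<^sup>b\<close> with \<open>p \<le> k\<close> and \<open>x\<^sub>k\<close> not the last variable of the block. It is applied to
  the variables above \<open>i\<close> and, with \<open>l = 1\<close>, to \<open>x\<^sub>2, \<dots>, x\<^sub>i\<close>.
\<close>

lemma standard_skew_block:
  assumes "standard b n i u" "1 \<le> l" "l + m \<le> n" "i \<le> l \<or> l + m \<le> i"
  shows "skew_digits b m (\<lambda>k. expo u (l + k))"
  unfolding skew_digits_def
proof (intro ballI conjI impI)
  fix k assume k: "k \<in> {1..<m}"
  have "\<not> mono_divides (anti_exp b (l + k - 1) (l + k)) u"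
    using assms k by (intro standard_anti[OF assms(1)]) auto
  then show "expo u (l + k) \<le> b"
    using anti_exp_divides(2)[of b u "l + k" "l + k - 1"] k by (cases "b < expo u (l + k)") auto
  fix p assume p: "p \<in> {1..<k}" and eq: "expo u (l + k) = b"
  have "\<not> mono_divides (anti_exp b (l + p - 1) (l + k)) u"
    using assms k p by (intro standard_anti[OF assms(1)]) auto
  then show "expo u (l + p) = 0"
    using anti_exp_divides(1)[of u "l + p - 1" b "l + k"] k p eq by auto
qed

text \<open>
  The monomials \<open>x\<^sub>j\<^sup>b x\<^sub>q\<close> with \<open>j < i < q\<close> forbid large exponents below \<open>i\<close> as soon as any variable above
  \<open>i\<close> is present.
\<close>

lemma standard_bounded_below:
  assumes "standard b n i u" "q \<in> {i+1..n}" "expo u q > 0" "j \<in> {1..<i}"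
  shows "expo u j < b"
proof (rule ccontr)
  assume "\<not> expo u j < b"
  then have "mono_divides (diag_exp b j (q - 1)) u"
    using assms(2-4) by (intro diag_exp_divides) auto
  moreover have "lead_exp b i j (q - 1) = diag_exp b j (q - 1)" "(j, q - 1) \<in> pairs n"
    using assms(2,4) by (auto simp: lead_exp_def pairs_def)
  ultimately show False using assms(1) by (force simp: standard_def)
qed

lemma sum_split_at:
  fixes f :: "nat \<Rightarrow> nat"
  assumes "i \<in> {1..n}"
  shows "(\<Sum>j=1..n. f j) = (\<Sum>j<i-1. f (j + 1)) + f i + (\<Sum>k=1..n-i. f (i + k))"
proof -
  obtain i' where i': "i = Suc i'" using assms by (cases i) auto
  obtain l where l: "n = i + l" using assms by (metis atLeastAtMost_iff le_Suc_ex)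
  have "(\<Sum>j=1..n. f j) = (\<Sum>j=1..i. f j) + (\<Sum>j=i+1..i+l. f j)"
    using sum.ub_add_nat[of 1 i f l] by (simp add: l i')
  also have "(\<Sum>j=i+1..i+l. f j) = (\<Sum>k=1..l. f (i + k))"
    using sum.shift_bounds_cl_nat_ivl[of f 1 i l] by (simp add: add.commute)
  also have "(\<Sum>j=1..i. f j) = (\<Sum>j<i-1. f (j + 1)) + f i"
    using sum.atLeast1_atMost_eq[of f i] by (simp add: i')
  finally show ?thesis by (simp add: l)
qed

text \<open>
  Comparing the weight of every variable with that of \<open>x\<^sub>i\<close>: a variable above \<open>i\<close> weighs
  \<open>b\<^bsup>i-1\<^esup> r\<^sub>b(q - i)\<close> more, and one below \<open>i\<close> weighs \<open>r\<^sub>b(i-1) - r\<^sub>b(j-1)\<close> less. The excess is divisible by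
  \<open>b\<^bsup>i-1\<^esup>\<close>, so modulo this power the bidegree sees only the exponents below \<open>i\<close>.
\<close>

lemma bidegree_balance:
  assumes "i \<in> {1..n}"
  shows "mwt b n u + (\<Sum>j<i-1. expo u (j + 1) * (repunit b (i - 1) - repunit b j))
    = mdeg n u * repunit b (i - 1) + b ^ (i - 1) * (\<Sum>k=1..n-i. expo u (i + k) * repunit b k)"
proof -
  let ?r = "repunit b (i - 1)"
  have lower: "(\<Sum>j<i-1. expo u (j + 1) * repunit b j) + (\<Sum>j<i-1. expo u (j + 1) * (?r - repunit b j))
     = (\<Sum>j<i-1. expo u (j + 1)) * ?r"
    unfolding sum.distrib[symmetric] sum_distrib_right
    by (intro sum.cong) (auto simp: repunit_mono add_mult_distrib2[symmetric])
  have "repunit b (i + k - 1) = ?r + b ^ (i - 1) * repunit b k" for k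
    using repunit_add[of b "i - 1" k] assms by simp
  then have upper: "(\<Sum>k=1..n-i. expo u (i + k) * repunit b (i + k - 1))
     = (\<Sum>k=1..n-i. expo u (i + k)) * ?r + b ^ (i - 1) * (\<Sum>k=1..n-i. expo u (i + k) * repunit b k)"
    by (simp add: sum_distrib_left sum_distrib_right sum.distrib algebra_simps)
  show ?thesis
    unfolding mwt_def mdeg_def sum_split_at[OF assms] add_mult_distrib
    using lower upper by simp
qed

text \<open>
  Let \<open>S\<close> and \<open>T\<close> be the total excess above \<open>i\<close> and the total deficit below \<open>i\<close>. Equal bidegrees give
  \<open>T u + b\<^bsup>i-1\<^esup> (S v - S u) = T v\<close>, where \<open>u\<close> and \<open>v\<close> may be ordered such that \<open>S u \<le> S v\<close>.

  If \<open>v\<close> involves a variable above \<open>i\<close>, then its exponents below \<open>i\<close> are smaller than \<open>b\<close>, so \<open>T v\<close> is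
  minimal in its class modulo \<open>b\<^bsup>i-1\<^esup>\<close>; hence \<open>S u = S v\<close> and the exponents below \<open>i\<close> agree. Otherwise
  \<open>S v = 0\<close>, which forces \<open>S u = 0\<close>. In either case the exponents above \<open>i\<close> agree, by uniqueness of
  skew expansions. In the second case the weight is a skew expansion with digits the exponents of
  \<open>x\<^sub>2, \<dots>, x\<^sub>i\<close>, so these agree as well. One exponent is then left, and the degree fixes it.
\<close>

lemma standard_unique:
  assumes "standard b n i u" "standard b n i v" "i \<in> {1..n}"
    and "mdeg n u = mdeg n v" "mwt b n u = mwt b n v"
    and "Poly_Mapping.keys u \<subseteq> {1..n}" "Poly_Mapping.keys v \<subseteq> {1..n}"
  shows "u = v"
proof -
  define S where "S u = (\<Sum>k=1..n-i. expo u (i + k) * repunit b k)" for u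
  define T where "T u = (\<Sum>j<i-1. expo u (j + 1) * (repunit b (i - 1) - repunit b j))" for u
  have main: "u = v" if std: "standard b n i u" "standard b n i v"
    and deg: "mdeg n u = mdeg n v" "mwt b n u = mwt b n v"
    and keys: "Poly_Mapping.keys u \<subseteq> {1..n}" "Poly_Mapping.keys v \<subseteq> {1..n}"
    and le: "S u \<le> S v" for u v
  proof -
    have "mwt b n u + T u + b ^ (i - 1) * S v = mwt b n v + T v + b ^ (i - 1) * S u"
      using bidegree_balance[OF assms(3), of b u] bidegree_balance[OF assms(3), of b v]
      unfolding S_def T_def deg by linarith
    then have TS: "T u + b ^ (i - 1) * (S v - S u) = T v"
      using le deg by (simp add: diff_mult_distrib2)
    have above_eqI: "\<forall>k\<in>{1..n-i}. expo u (i + k) = expo v (i + k)" if "S u = S v"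
      using that assms(3) unfolding S_def
      by (intro skew_digits_unique[of b] standard_skew_block[OF std(1)] standard_skew_block[OF std(2)]) auto
    have "(\<forall>k\<in>{1..n-i}. expo u (i + k) = expo v (i + k)) \<and>
          ((\<forall>j<i-1. expo u (j + 1) = expo v (j + 1)) \<or> (\<forall>j\<in>{1..i-1}. expo u (1 + j) = expo v (1 + j)))"
    proof (cases "\<exists>q\<in>{i+1..n}. expo v q > 0")
      case True
      then have "\<forall>j<i-1. expo v (j + 1) < b"
        using standard_bounded_below[OF std(2)] by auto
      from bounded_digits_minimal[OF this TS[unfolded T_def]]
      show ?thesis using above_eqI le by auto
    next
      case False
      then have "S v = 0" by (auto simp: S_def)
      then have above: "\<forall>k\<in>{1..n-i}. expo u (i + k) = expo v (i + k)" using above_eqI le by simp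
      have mwt: "mwt b n w = (\<Sum>j=1..i-1. expo w (1 + j) * repunit b j)
          + (\<Sum>k=1..n-i. expo w (i + k) * repunit b (i + k - 1))" for w
      proof -
        obtain l where l: "i = Suc l" using assms(3) by (cases i) auto
        have "(\<Sum>j<i-1. expo w (j + 1) * repunit b j) + expo w i * repunit b (i - 1)
           = (\<Sum>j<Suc l. expo w (j + 1) * repunit b j)"
          by (simp add: l)
        also have "\<dots> = (\<Sum>j<l. expo w (Suc j + 1) * repunit b (Suc j))"
          by (simp only: sum.lessThan_Suc_shift) simp
        also have "\<dots> = (\<Sum>j=1..i-1. expo w (1 + j) * repunit b j)"
          by (simp add: l sum.atLeast1_atMost_eq)
        finally show ?thesis unfolding mwt_def sum_split_at[OF assms(3)] by simp
      qed
      have "(\<Sum>j=1..i-1. expo u (1 + j) * repunit b j) = (\<Sum>j=1..i-1. expo v (1 + j) * repunit b j)"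
        using deg(2) above unfolding mwt by simp
      then have "\<forall>j\<in>{1..i-1}. expo u (1 + j) = expo v (1 + j)"
        using assms(3)
        by (intro skew_digits_unique[of b] standard_skew_block[OF std(1)] standard_skew_block[OF std(2)]) auto
      then show ?thesis using above by blast
    qed
    then have above: "\<forall>k\<in>{1..n-i}. expo u (i + k) = expo v (i + k)"
      and below: "(\<forall>j<i-1. expo u (j + 1) = expo v (j + 1)) \<or> (\<forall>j\<in>{1..i-1}. expo u (1 + j) = expo v (1 + j))"
      by blast+
    \<comment> \<open>The index not yet accounted for: the weight sees no \<open>x\<^sub>1\<close>, and the balance sees no \<open>x\<^sub>i\<close>.\<close>
    define e where "e = (if \<forall>j<i-1. expo u (j + 1) = expo v (j + 1) then i else 1)"
    have others: "expo u q = expo v q" if "q \<in> {1..n}" "q \<noteq> e" for q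
    proof (cases "q \<le> i")
      case True
      then show ?thesis using that below
        by (auto simp: e_def split: if_splits dest!: spec[of _ "q - 1"] bspec[of _ _ "q - 1"])
    next
      case False
      then show ?thesis using that above by (auto dest!: bspec[of _ _ "q - i"])
    qed
    have e: "e \<in> {1..n}" using assms(3) by (auto simp: e_def)
    have "mdeg n w = expo w e + sum (expo w) ({1..n} - {e})" for w
      unfolding mdeg_def using e by (simp add: sum.remove)
    moreover have "sum (expo u) ({1..n} - {e}) = sum (expo v) ({1..n} - {e})"
      using others by (intro sum.cong) auto
    ultimately have "expo u e = expo v e" using deg(1) by simp
    then have "expo u q = expo v q" if "q \<in> {1..n}" for q using others that by metis
    then show "u = v" using keys by (metis in_keys_iff poly_mapping_eqI subsetD)
  qed
  show ?thesis
    using main[OF assms(1,2,4-7)] main[OF assms(2,1) assms(4,5)[symmetric] assms(7,6)]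
    by (cases "S u \<le> S v") auto
qed

section \<open>The polynomial ring and its ideals\<close>

lemma poly_ring_operations [simp]:
  "mult (poly_ring n) = (*)" "add (poly_ring n) = (+)"
  "one (poly_ring n) = 1" "zero (poly_ring n) = 0"
  by (simp_all add: poly_ring_def)

lemma in_poly_ring:
  "p \<in> carrier (poly_ring n) \<longleftrightarrow> (\<forall>u\<in>Poly_Mapping.keys p. Poly_Mapping.keys u \<subseteq> {1..n})"
  by (simp add: poly_ring_def)

lemma poly_ring_add_closed:
  "p \<in> carrier (poly_ring n) \<Longrightarrow> q \<in> carrier (poly_ring n) \<Longrightarrow> p + q \<in> carrier (poly_ring n)"
  unfolding in_poly_ring using keys_add[of p q] by blast

lemma poly_ring_uminus_closed:
  "p \<in> carrier (poly_ring n) \<Longrightarrow> - p \<in> carrier (poly_ring n)"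
  by (simp add: in_poly_ring in_keys_iff)

lemma poly_ring_mult_closed:
  assumes "p \<in> carrier (poly_ring n)" "q \<in> carrier (poly_ring n)"
  shows "p * q \<in> carrier (poly_ring n)"
  unfolding in_poly_ring
proof
  fix w assume "w \<in> Poly_Mapping.keys (p * q)"
  then obtain u v where "w = u + v" "u \<in> Poly_Mapping.keys p" "v \<in> Poly_Mapping.keys q"
    using keys_mult[of p q] by blast
  then show "Poly_Mapping.keys w \<subseteq> {1..n}"
    using assms keys_add[of u v] unfolding in_poly_ring by blast
qed

lemma poly_ring_single:
  "Poly_Mapping.keys u \<subseteq> {1..n} \<Longrightarrow> Poly_Mapping.single u c \<in> carrier (poly_ring n)"
  by (simp add: in_poly_ring)

lemma ring_poly_ring: "ring (poly_ring n :: 'k::field mpoly ring)"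
proof (intro ringI abelian_groupI monoidI)
  fix x :: "'k mpoly" assume x: "x \<in> carrier (poly_ring n)"
  have "- x \<oplus>\<^bsub>poly_ring n\<^esub> x = \<zero>\<^bsub>poly_ring n\<^esub>" by simp
  then show "\<exists>y\<in>carrier (poly_ring n). y \<oplus>\<^bsub>poly_ring n\<^esub> x = \<zero>\<^bsub>poly_ring n\<^esub>"
    using poly_ring_uminus_closed[OF x] by blast
next
  fix x y :: "'k mpoly" assume "x \<in> carrier (poly_ring n)" "y \<in> carrier (poly_ring n)"
  then show "x \<oplus>\<^bsub>poly_ring n\<^esub> y \<in> carrier (poly_ring n)" "x \<otimes>\<^bsub>poly_ring n\<^esub> y \<in> carrier (poly_ring n)"
    by (simp_all add: poly_ring_add_closed poly_ring_mult_closed)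
qed (simp_all add: in_poly_ring algebra_simps)

lemma a_inv_poly_ring: "p \<in> carrier (poly_ring n) \<Longrightarrow> \<ominus>\<^bsub>poly_ring n\<^esub> p = - p"
  by (intro abelian_group.minus_equality[OF ring.is_abelian_group[OF ring_poly_ring]] poly_ring_uminus_closed)
     simp_all

lemma ideal_poly_ringI:
  assumes "I \<subseteq> carrier (poly_ring n)" "0 \<in> I"
    and "\<And>p q. p \<in> I \<Longrightarrow> q \<in> I \<Longrightarrow> p + q \<in> I" "\<And>p. p \<in> I \<Longrightarrow> - p \<in> I"
    and "\<And>p q. p \<in> I \<Longrightarrow> q \<in> carrier (poly_ring n) \<Longrightarrow> q * p \<in> I"
  shows "ideal I (poly_ring n)"
proof (rule idealI[OF ring_poly_ring])
  have "inv\<^bsub>add_monoid (poly_ring n)\<^esub> p = - p" if "p \<in> I" for p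
    using a_inv_poly_ring[of p n] that assms(1) by (auto simp: a_inv_def)
  then show "subgroup I (add_monoid (poly_ring n))"
    using assms(1-4) by (intro subgroup.intro) auto
  show "q \<otimes>\<^bsub>poly_ring n\<^esub> p \<in> I" "p \<otimes>\<^bsub>poly_ring n\<^esub> q \<in> I"
    if "p \<in> I" "q \<in> carrier (poly_ring n)" for p q
    using assms(5)[OF that] by (simp_all add: mult.commute)
qed

lemma ideal_mult_closed:
  "ideal I (poly_ring n) \<Longrightarrow> p \<in> I \<Longrightarrow> q \<in> carrier (poly_ring n) \<Longrightarrow> q * p \<in> I"
  using ideal.I_l_closed[of I "poly_ring n" p q] by simp

lemma ideal_uminus_closed:
  fixes I :: "'a::field mpoly set"
  assumes "ideal I (poly_ring n)" "p \<in> I"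
  shows "- p \<in> I"
proof -
  have "- 1 \<in> carrier (poly_ring n :: 'a mpoly ring)"
    by (intro poly_ring_uminus_closed) (simp add: in_poly_ring)
  from ideal_mult_closed[OF assms this] show ?thesis by simp
qed

section \<open>Coefficient sums along the bidegree\<close>

text \<open>
  With \<open>g\<close> the indicator of one bidegree this is the sum of the coefficients of \<open>p\<close> on that fibre.
  Allowing an arbitrary \<open>g\<close> makes multiplication by a monomial a mere change of \<open>g\<close>.
\<close>

definition fibre_sum :: "nat \<Rightarrow> nat \<Rightarrow> (nat \<Rightarrow> nat \<Rightarrow> 'k) \<Rightarrow> 'k::field mpoly \<Rightarrow> 'k" where
  "fibre_sum b n g p = (\<Sum>u\<in>Poly_Mapping.keys p. Poly_Mapping.lookup p u * g (mdeg n u) (mwt b n u))"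

lemma fibre_sum_add: "fibre_sum b n g (p + q) = fibre_sum b n g p + fibre_sum b n g q"
  unfolding fibre_sum_def
  by (rule setsum_keys_plus_distrib[of "\<lambda>u c. c * g (mdeg n u) (mwt b n u)"]) (simp_all add: algebra_simps)

lemma fibre_sum_zero [simp]: "fibre_sum b n g 0 = 0"
  by (simp add: fibre_sum_def)

lemma fibre_sum_uminus: "fibre_sum b n g (- p) = - fibre_sum b n g p"
  using fibre_sum_add[of b n g p "- p"] by (simp add: eq_neg_iff_add_eq_0 add.commute)

lemma fibre_sum_single: "fibre_sum b n g (Poly_Mapping.single u c) = c * g (mdeg n u) (mwt b n u)"
  by (simp add: fibre_sum_def)

lemma mpoly_induct [case_names zero single_add]:
  fixes p :: "'k::field mpoly"
  assumes "P 0" and "\<And>u c p. P p \<Longrightarrow> P (Poly_Mapping.single u c + p)"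
  shows "P p"
proof (induction p rule: update_induct)
  case const
  then show ?case by (rule assms(1))
next
  case (update p u c)
  have "Poly_Mapping.update u c p = Poly_Mapping.single u c + p"
    using update.hyps by (intro poly_mapping_eqI)
      (auto simp: lookup_update lookup_add lookup_single when_def in_keys_iff)
  then show ?case using assms(2) update by simp
qed

lemma fibre_sum_single_mult:
  "fibre_sum b n g (Poly_Mapping.single v c * p)
     = c * fibre_sum b n (\<lambda>x y. g (mdeg n v + x) (mwt b n v + y)) p"
  by (induction p rule: mpoly_induct)
     (simp_all add: distrib_left fibre_sum_add mult_single fibre_sum_single mdeg_add mwt_add)

text \<open>
  This is the toric ideal of the bidegree: the kernel of the homomorphism that sends every monomial to
  its bidegree, viewed as a monomial in two variables.
\<close>

lemma ideal_fibre_sum_zero: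
  "ideal {p \<in> carrier (poly_ring n). \<forall>g. fibre_sum b n g p = (0::'k::field)} (poly_ring n)"
proof (rule ideal_poly_ringI)
  fix p q :: "'k mpoly"
  assume p: "p \<in> {p \<in> carrier (poly_ring n). \<forall>g. fibre_sum b n g p = 0}" and q: "q \<in> carrier (poly_ring n)"
  have "fibre_sum b n g (q * p) = 0" for g
    using p by (induction q rule: mpoly_induct)
      (simp_all add: distrib_right fibre_sum_add fibre_sum_single_mult)
  then show "q * p \<in> {p \<in> carrier (poly_ring n). \<forall>g. fibre_sum b n g p = 0}"
    using p q poly_ring_mult_closed by blast
qed (auto simp: fibre_sum_add fibre_sum_uminus poly_ring_add_closed poly_ring_uminus_closed in_poly_ring[of 0])

lemma X_power: "X j ^ b = Poly_Mapping.single (Poly_Mapping.single j b) 1"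
  by (induction b) (simp_all add: X_def mult_single single_add[symmetric])

definition mono_diff :: "mono \<Rightarrow> mono \<Rightarrow> 'k::field mpoly" where
  "mono_diff u v = Poly_Mapping.single u 1 - Poly_Mapping.single v 1"

lemma uminus_mono_diff: "- mono_diff u v = mono_diff v u"
  by (simp add: mono_diff_def)

lemma diag_product: "X j ^ b * X (k + 1) = Poly_Mapping.single (diag_exp b j k) 1"
  by (simp add: X_power diag_exp_def mult_single) (simp add: X_def mult_single)

lemma anti_product: "X (j + 1) * X k ^ b = Poly_Mapping.single (anti_exp b j k) 1"
  by (simp add: X_power anti_exp_def mult_single) (simp add: X_def mult_single)

lemma minors2_Y_eq: "minors2 (Y b) (n - 1) = (\<lambda>(j, k). mono_diff (diag_exp b j k) (anti_exp b j k)) ` pairs n"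
proof -
  have "Y b 1 j * Y b 2 k - Y b 1 k * Y b 2 j = mono_diff (diag_exp b j k) (anti_exp b j k)" for j k
    unfolding Y_def mono_diff_def diag_product[symmetric] anti_product[symmetric]
    by (simp add: mult.commute)
  then show ?thesis unfolding minors2_def pairs_def by (force simp: image_iff)
qed

lemma GY_eq:
  assumes "i \<in> {1..n}"
  shows "GY b n i = (\<lambda>(j, k). mono_diff (lead_exp b i j k) (trail_exp b i j k)) ` pairs n"
proof -
  let ?g = "\<lambda>j k. mono_diff (lead_exp b i j k) (trail_exp b i j k) :: 'a mpoly"
  have range1: "j \<in> {i..n-2} \<and> k \<in> {j+1..n-1} \<longleftrightarrow> (j, k) \<in> pairs n \<and> i \<le> j" for j k
    using assms by (auto simp: pairs_def)
  have range2: "j \<in> {1..i-2} \<and> k \<in> {j+1..i-1} \<longleftrightarrow> (j, k) \<in> pairs n \<and> k < i" for j k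
    using assms by (auto simp: pairs_def)
  have range3: "j \<in> {1..i-1} \<and> k \<in> {i..n-1} \<longleftrightarrow> (j, k) \<in> pairs n \<and> j < i \<and> i \<le> k" for j k
    using assms by (auto simp: pairs_def)
  have img: "{f j k | j k. P j k} = (\<lambda>(j, k). f j k) ` {(j, k). P j k}"
    for f :: "nat \<Rightarrow> nat \<Rightarrow> 'a mpoly" and P by auto
  have G1: "G1 b n i = (\<lambda>(j, k). ?g j k) ` {(j, k). (j, k) \<in> pairs n \<and> i \<le> j}"
    unfolding G1_def range1 diag_product anti_product img
    by (intro image_cong refl) (auto simp: lead_exp_def trail_exp_def mono_diff_def)
  have G2: "G2 b i = (\<lambda>(j, k). ?g j k) ` {(j, k). (j, k) \<in> pairs n \<and> k < i}"
    unfolding G2_def range2 diag_product anti_product img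
    by (intro image_cong refl) (auto simp: lead_exp_def trail_exp_def mono_diff_def)
  have G3: "G3 b n i = (\<lambda>(j, k). ?g j k) ` {(j, k). (j, k) \<in> pairs n \<and> j < i \<and> i \<le> k}"
    unfolding G3_def range3 diag_product anti_product img
    by (intro image_cong refl) (auto simp: lead_exp_def trail_exp_def mono_diff_def)
  have "pairs n = {(j, k). (j, k) \<in> pairs n \<and> i \<le> j} \<union> {(j, k). (j, k) \<in> pairs n \<and> k < i}
      \<union> {(j, k). (j, k) \<in> pairs n \<and> j < i \<and> i \<le> k}"
    by auto
  then show ?thesis unfolding GY_def G1 G2 G3 image_Un[symmetric] by simp
qed

lemma mono_diff_in_poly_ring:
  "Poly_Mapping.keys u \<subseteq> {1..n} \<Longrightarrow> Poly_Mapping.keys v \<subseteq> {1..n} \<Longrightarrow> mono_diff u v \<in> carrier (poly_ring n)"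
  unfolding mono_diff_def diff_conv_add_uminus
  by (intro poly_ring_add_closed poly_ring_uminus_closed poly_ring_single)

lemma minors2_Y_subset_carrier: "minors2 (Y b) (n - 1) \<subseteq> carrier (poly_ring n)"
  unfolding minors2_Y_eq
proof (rule image_subsetI, clarify)
  fix j k assume "(j, k) \<in> pairs n"
  then show "mono_diff (diag_exp b j k) (anti_exp b j k) \<in> carrier (poly_ring n)"
    by (intro mono_diff_in_poly_ring keys_diag_anti_exp)
qed

lemma ideal_I2Y: "ideal (I2Y b n) (poly_ring n)"
  unfolding I2Y_def by (rule ring.genideal_ideal[OF ring_poly_ring minors2_Y_subset_carrier])

lemma GY_subset_I2Y:
  assumes "i \<in> {1..n}"
  shows "GY b n i \<subseteq> I2Y b n"
proof -
  have *: "mono_diff (diag_exp b j k) (anti_exp b j k) \<in> I2Y b n" if "(j, k) \<in> pairs n" for j k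
    using ring.genideal_self[OF ring_poly_ring minors2_Y_subset_carrier[of b n]] that
    unfolding I2Y_def minors2_Y_eq by auto
  show ?thesis
    unfolding GY_eq[OF assms] lead_exp_def trail_exp_def
    using * ideal_uminus_closed[OF ideal_I2Y *] by (auto simp: uminus_mono_diff)
qed

text \<open>
  The determinantal ideal is contained in the toric ideal because its generators are differences of
  monomials of equal bidegree.
\<close>

lemma fibre_sum_I2Y:
  assumes "f \<in> I2Y b n"
  shows "fibre_sum b n g f = 0"
proof -
  have "minors2 (Y b) (n - 1) \<subseteq> {p \<in> carrier (poly_ring n). \<forall>g. fibre_sum b n g p = (0::'a)}"
    using minors2_Y_subset_carrier unfolding minors2_Y_eq
    by (auto simp: mono_diff_def diff_conv_add_uminus fibre_sum_add fibre_sum_uminus fibre_sum_single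
        bidegree_diag_anti_exp simp del: add_uminus_conv_diff)
  then have "I2Y b n \<subseteq> {p \<in> carrier (poly_ring n). \<forall>g. fibre_sum b n g p = (0::'a)}"
    unfolding I2Y_def by (rule ring.genideal_minimal[OF ring_poly_ring ideal_fibre_sum_zero])
  then show ?thesis using assms by blast
qed

section \<open>Leading monomials of polynomials\<close>

lemma lead_mono_eqI:
  assumes "u \<in> Poly_Mapping.keys p" "\<And>v. v \<in> Poly_Mapping.keys p \<Longrightarrow> v \<noteq> u \<Longrightarrow> ord_less a b n i v u"
  shows "lead_mono (ord_less a b n i) p = u"
  unfolding lead_mono_def
proof (rule the_equality)
  fix w assume w: "w \<in> Poly_Mapping.keys p \<and> (\<forall>v\<in>Poly_Mapping.keys p. v \<noteq> w \<longrightarrow> ord_less a b n i v w)"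
  show "w = u" using w assms(1) assms(2)[of w] ord_less_asym by metis
qed (use assms in blast)

lemma lead_mono_greatest:
  assumes "p \<in> carrier (poly_ring n)" "p \<noteq> 0" "i \<le> n"
  shows "lead_mono (ord_less a b n i) p \<in> Poly_Mapping.keys p"
    and "\<And>v. v \<in> Poly_Mapping.keys p \<Longrightarrow> v \<noteq> lead_mono (ord_less a b n i) p \<Longrightarrow>
           ord_less a b n i v (lead_mono (ord_less a b n i) p)"
proof -
  have "\<exists>u\<in>Poly_Mapping.keys p. \<forall>v\<in>Poly_Mapping.keys p. v \<noteq> u \<longrightarrow> ord_less a b n i v u"
  proof (rule finite_has_least[where R = "\<lambda>u v. ord_less a b n i v u"])
    show "finite (Poly_Mapping.keys p)" "Poly_Mapping.keys p \<noteq> {}" using assms(2) by simp_all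
    show "\<not> ord_less a b n i u u" for u using ord_less_asym by blast
    show "ord_less a b n i w u" if "ord_less a b n i v u" "ord_less a b n i w v" for u v w
      using ord_less_trans that by blast
    show "ord_less a b n i v u \<or> ord_less a b n i u v"
      if "u \<in> Poly_Mapping.keys p" "v \<in> Poly_Mapping.keys p" "u \<noteq> v" for u v
      using ord_less_total[OF assms(3)] that assms(1) unfolding in_poly_ring by metis
  qed
  then obtain u where u: "u \<in> Poly_Mapping.keys p"
    "\<And>v. v \<in> Poly_Mapping.keys p \<Longrightarrow> v \<noteq> u \<Longrightarrow> ord_less a b n i v u" by blast
  have "lead_mono (ord_less a b n i) p = u" using u by (rule lead_mono_eqI)
  then show "lead_mono (ord_less a b n i) p \<in> Poly_Mapping.keys p"
    "\<And>v. v \<in> Poly_Mapping.keys p \<Longrightarrow> v \<noteq> lead_mono (ord_less a b n i) p \<Longrightarrow>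
           ord_less a b n i v (lead_mono (ord_less a b n i) p)"
    using u by simp_all
qed

lemma mono_diff_leading_data:
  assumes "ord_less a b n i v u"
  shows "Poly_Mapping.keys (mono_diff u v :: 'k::field mpoly) = {u, v}"
    and "lead_mono (ord_less a b n i) (mono_diff u v :: 'k mpoly) = u"
    and "lead_coef (ord_less a b n i) (mono_diff u v :: 'k mpoly) = 1"
    and "(mono_diff u v :: 'k mpoly) \<noteq> 0"
proof -
  have ne: "u \<noteq> v" using assms ord_less_asym by blast
  show k: "Poly_Mapping.keys (mono_diff u v :: 'k mpoly) = {u, v}"
    using ne by (auto simp: in_keys_iff mono_diff_def lookup_minus lookup_single when_def split: if_splits)
  show l: "lead_mono (ord_less a b n i) (mono_diff u v :: 'k mpoly) = u"
    using assms by (intro lead_mono_eqI) (auto simp: k)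
  show "lead_coef (ord_less a b n i) (mono_diff u v :: 'k mpoly) = 1"
    using ne unfolding lead_coef_def l by (simp add: mono_diff_def lookup_minus lookup_single)
  show "(mono_diff u v :: 'k mpoly) \<noteq> 0" using k by force
qed

lemma mono_dividesE:
  assumes "mono_divides u v"
  obtains w where "v = u + w"
proof
  show "v = u + (v - u)"
    using assms by (intro poly_mapping_eqI) (simp add: lookup_add lookup_minus mono_divides_def)
qed

section \<open>The Groebner basis\<close>

text \<open>
  Suppose that the leading monomial \<open>u\<close> of \<open>f\<close> were standard. The coefficients of \<open>f\<close> on the fibre \<open>F\<close>
  of \<open>u\<close> sum to zero, so another monomial \<open>v\<close> of \<open>f\<close> lies in \<open>F\<close>, and it is smaller than \<open>u\<close>. The
  smallest element \<open>w\<close> of \<open>F\<close> is standard too: replacing a leading term that divides it by the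
  corresponding trailing term would give a smaller element of \<open>F\<close>. By uniqueness \<open>w = u\<close>, which
  contradicts the existence of \<open>v\<close>.
\<close>

lemma lead_mono_I2Y_divisible:
  fixes f :: "'k::field mpoly"
  assumes "f \<in> I2Y b n" "f \<noteq> 0" "i \<in> {1..n}" "b > 0"
  shows "\<exists>(j, k)\<in>pairs n. mono_divides (lead_exp b i j k) (lead_mono (ord_less a b n i) f)"
proof (rule ccontr)
  let ?lt = "ord_less a b n i"
  define u where "u = lead_mono ?lt f"
  assume "\<not> ?thesis"
  then have std_u: "standard b n i u" by (auto simp: standard_def u_def)
  have f: "f \<in> carrier (poly_ring n)"
    using additive_subgroup.a_Hcarr[OF ideal.axioms(1)[OF ideal_I2Y]] assms(1) by blast
  have u: "u \<in> Poly_Mapping.keys f" "\<And>v. v \<in> Poly_Mapping.keys f \<Longrightarrow> v \<noteq> u \<Longrightarrow> ?lt v u"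
    using lead_mono_greatest[OF f assms(2)] assms(3) by (auto simp: u_def)
  have keys_f: "Poly_Mapping.keys v \<subseteq> {1..n}" if "v \<in> Poly_Mapping.keys f" for v
    using f that by (simp add: in_poly_ring)
  define F where "F = {w. Poly_Mapping.keys w \<subseteq> {1..n} \<and> mdeg n w = mdeg n u \<and> mwt b n w = mwt b n u}"
  have uF: "u \<in> F" using keys_f[OF u(1)] by (simp add: F_def)
  have "\<exists>v\<in>Poly_Mapping.keys f. v \<in> F \<and> v \<noteq> u"
  proof (rule ccontr)
    assume "\<not> ?thesis"
    then have none: "v \<notin> F" if "v \<in> Poly_Mapping.keys f" "v \<noteq> u" for v using that by blast
    have "0 = fibre_sum b n (\<lambda>x y. if x = mdeg n u \<and> y = mwt b n u then 1 else 0) f"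
      using fibre_sum_I2Y[OF assms(1)] by simp
    also have "\<dots> = (\<Sum>w\<in>Poly_Mapping.keys f. if w = u then Poly_Mapping.lookup f u else 0)"
      unfolding fibre_sum_def using none keys_f by (intro sum.cong) (auto simp: F_def)
    also have "\<dots> = Poly_Mapping.lookup f u" using u(1) by simp
    finally show False using u(1) by (simp add: in_keys_iff)
  qed
  then obtain v where v: "v \<in> Poly_Mapping.keys f" "v \<in> F" "v \<noteq> u" by blast
  have "finite F"
    by (rule finite_subset[OF _ finite_bounded_monomials[of n "mdeg n u"]]) (auto simp: F_def)
  have "\<exists>w\<in>F. \<forall>x\<in>F. x \<noteq> w \<longrightarrow> ?lt w x"
  proof (rule finite_has_least)
    show "finite F" by fact
    show "F \<noteq> {}" using uF by blast
    show "\<not> ?lt x x" for x using ord_less_asym by blast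
    show "?lt x z" if "?lt x y" "?lt y z" for x y z using ord_less_trans that by blast
    show "?lt x y \<or> ?lt y x" if "x \<in> F" "y \<in> F" "x \<noteq> y" for x y
      using ord_less_total[of i n x y] that assms(3) by (simp add: F_def)
  qed
  then obtain w where w: "w \<in> F" "\<And>x. x \<in> F \<Longrightarrow> x \<noteq> w \<Longrightarrow> ?lt w x" by blast
  have "standard b n i w"
    unfolding standard_def
  proof clarify
    fix j k assume jk: "(j, k) \<in> pairs n" and "mono_divides (lead_exp b i j k) w"
    then obtain x where x: "w = lead_exp b i j k + x" by (auto elim: mono_dividesE)
    define y where "y = trail_exp b i j k + x"
    have lt: "?lt y w"
      using ord_less_add[OF trail_less_lead[OF jk assms(4,3)], of a x] by (simp add: x y_def add.commute)
    have "Poly_Mapping.keys x \<subseteq> Poly_Mapping.keys w"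
      by (auto simp: x in_keys_iff lookup_add)
    then have "Poly_Mapping.keys y \<subseteq> {1..n}"
      using w(1) keys_lead_trail_exp(2)[OF jk, of b i] keys_add[of "trail_exp b i j k" x]
      unfolding y_def F_def by blast
    then have "y \<in> F"
      using w(1) bidegree_lead_trail_exp[OF jk, of b i] by (simp add: F_def x y_def mdeg_add mwt_add)
    then show False using w(2)[of y] lt ord_less_asym by blast
  qed
  then have "w = u"
    using standard_unique[OF _ std_u assms(3)] w(1) uF by (auto simp: F_def)
  then show False using w(2)[OF v(2)] v(3) u(2)[OF v(1,3)] ord_less_asym by blast
qed

lemma groebner_basis_GY:
  assumes "b > 0" "i \<in> {1..n}"
  shows "groebner_basis n (ord_less a b n i) (I2Y b n) (GY b n i :: 'k::field mpoly set)"
proof -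
  let ?lt = "ord_less a b n i" and ?G = "GY b n i :: 'k mpoly set" and ?I = "I2Y b n :: 'k mpoly set"
  have "pairs n \<subseteq> {..<n} \<times> {..<n}" by (auto simp: pairs_def)
  then have "finite (pairs n)" by (rule finite_subset) simp
  then have fin: "finite ?G" by (simp add: GY_eq[OF assms(2)])
  have sub: "?G \<subseteq> ?I" by (rule GY_subset_I2Y[OF assms(2)])
  have I_carrier: "?I \<subseteq> carrier (poly_ring n)"
    using additive_subgroup.a_subset[OF ideal.axioms(1)[OF ideal_I2Y]] .
  let ?L = "lead_term ?lt ` (?G - {0})"
  have L_carrier: "lead_term ?lt ` (?I - {0}) \<subseteq> carrier (poly_ring n)"
  proof (rule image_subsetI)
    fix f assume "f \<in> ?I - {0}"
    then have "f \<in> carrier (poly_ring n)" "lead_mono ?lt f \<in> Poly_Mapping.keys f"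
      using I_carrier lead_mono_greatest(1)[of f n i] assms(2) by auto
    then show "lead_term ?lt f \<in> carrier (poly_ring n)"
      unfolding lead_term_def by (intro poly_ring_single) (simp add: in_poly_ring)
  qed
  have L_sub: "?L \<subseteq> carrier (poly_ring n)" using L_carrier sub by blast
  have L_ideal: "ideal (Idl\<^bsub>poly_ring n\<^esub> ?L) (poly_ring n)"
    by (rule ring.genideal_ideal[OF ring_poly_ring L_sub])
  have "lead_term ?lt f \<in> Idl\<^bsub>poly_ring n\<^esub> ?L" if f: "f \<in> ?I" "f \<noteq> 0" for f
  proof -
    obtain j k where jk: "(j, k) \<in> pairs n" "mono_divides (lead_exp b i j k) (lead_mono ?lt f)"
      using lead_mono_I2Y_divisible[OF f assms(2,1)] by blast
    then obtain w where w: "lead_mono ?lt f = lead_exp b i j k + w" by (auto elim: mono_dividesE)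
    let ?g = "mono_diff (lead_exp b i j k) (trail_exp b i j k) :: 'k mpoly"
    note g = mono_diff_leading_data[OF trail_less_lead[OF jk(1) assms(1,2)], where 'k = 'k]
    have "?g \<in> ?G - {0}" using jk(1) g(4) by (auto simp: GY_eq[OF assms(2)])
    moreover have "lead_term ?lt ?g = Poly_Mapping.single (lead_exp b i j k) 1"
      by (simp add: lead_term_def g)
    ultimately have "Poly_Mapping.single (lead_exp b i j k) 1 \<in> ?L" by (metis imageI)
    then have gen: "Poly_Mapping.single (lead_exp b i j k) 1 \<in> Idl\<^bsub>poly_ring n\<^esub> ?L"
      using ring.genideal_self[OF ring_poly_ring L_sub] by blast
    have "lead_mono ?lt f \<in> Poly_Mapping.keys f" "f \<in> carrier (poly_ring n)"
      using I_carrier lead_mono_greatest(1)[of f n i] assms(2) f by auto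
    then have "Poly_Mapping.keys (lead_mono ?lt f) \<subseteq> {1..n}" by (simp add: in_poly_ring)
    then have "Poly_Mapping.keys w \<subseteq> {1..n}" unfolding w by (auto simp: in_keys_iff lookup_add)
    then have "Poly_Mapping.single w (lead_coef ?lt f) * Poly_Mapping.single (lead_exp b i j k) 1
        \<in> Idl\<^bsub>poly_ring n\<^esub> ?L"
      by (intro ideal_mult_closed[OF L_ideal gen] poly_ring_single)
    then show ?thesis by (simp add: lead_term_def w mult_single add.commute)
  qed
  then have "initial_ideal n ?lt ?I \<subseteq> initial_ideal n ?lt ?G"
    unfolding initial_ideal_def
    by (intro ring.genideal_minimal[OF ring_poly_ring L_ideal]) blast
  moreover have "initial_ideal n ?lt ?G \<subseteq> initial_ideal n ?lt ?I"
    unfolding initial_ideal_def genideal_def using sub by blast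
  ultimately show ?thesis using fin sub by (simp add: groebner_basis_def)
qed

lemma card_pairs: "card (pairs n) = (n - 1) choose 2"
proof (induction n)
  case 0
  then show ?case by (simp add: pairs_def)
next
  case (Suc n)
  have fin: "finite (pairs n)"
    by (rule finite_subset[of _ "{..<n} \<times> {..<n}"]) (auto simp: pairs_def)
  have "pairs (Suc n) = pairs n \<union> (\<lambda>j. (j, n)) ` {1..<n}"
    by (auto simp: pairs_def less_Suc_eq)
  moreover have "pairs n \<inter> (\<lambda>j. (j, n)) ` {1..<n} = {}" by (auto simp: pairs_def)
  moreover have "card ((\<lambda>j. (j, n)) ` {1..<n}) = n - 1"
    by (subst card_image) (auto simp: inj_on_def)
  ultimately have "card (pairs (Suc n)) = ((n - 1) choose 2) + (n - 1)"
    using fin Suc by (simp add: card_Un_disjoint)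
  then show ?case by (cases n) (simp_all add: numeral_2_eq_2)
qed

theorem proposition3:
  fixes a b n i :: nat
  assumes "a > 0" and "b > 0" and "n > 1" and "i \<in> {1..n}"
  shows "minimal_groebner_basis n (ord_less a b n i) (I2Y b n) (GY b n i :: 'k::field mpoly set)
    \<and> (b > 1 \<or> n \<le> 4 \<or> (n = 5 \<and> i \<in> {2, 4}) \<longrightarrow>
         reduced_groebner_basis n (ord_less a b n i) (I2Y b n) (GY b n i :: 'k mpoly set))
    \<and> card (GY b n i :: 'k mpoly set) = (n - 1) choose 2"
proof -
  let ?lt = "ord_less a b n i" and ?G = "GY b n i :: 'k mpoly set"
  define g :: "nat \<Rightarrow> nat \<Rightarrow> 'k mpoly" where
    "g j k = mono_diff (lead_exp b i j k) (trail_exp b i j k)" for j k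
  have G: "?G = (\<lambda>(j, k). g j k) ` pairs n" unfolding g_def by (rule GY_eq[OF assms(4)])
  have g: "Poly_Mapping.keys (g j k) = {lead_exp b i j k, trail_exp b i j k}"
    "lead_mono ?lt (g j k) = lead_exp b i j k" "lead_coef ?lt (g j k) = 1" "g j k \<noteq> 0"
    if "(j, k) \<in> pairs n" for j k
    using mono_diff_leading_data[OF trail_less_lead[OF that assms(2,4)]] by (simp_all add: g_def)
  have inject: "j = j' \<and> k = k'"
    if "(j, k) \<in> pairs n" "(j', k') \<in> pairs n" "lead_exp b i j k = lead_exp b i j' k'" for j k j' k'
    using lead_exp_inject[OF that(3) _ _ assms(2)] that(1,2) by (auto simp: pairs_def)
  have lead: "g j k = g j' k'"
    if "(j, k) \<in> pairs n" "(j', k') \<in> pairs n" "mono_divides (lead_exp b i j k) (lead_exp b i j' k')" for j k j' k'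
    using inject[OF that(1,2)] mono_divides_same_mdeg[OF that(3), of n]
      bidegree_lead_trail_exp(1) keys_lead_trail_exp(1) that(1,2) by metis
  have trail: "\<not> mono_divides (lead_exp b i j k) (trail_exp b i j' k')"
    if "(j, k) \<in> pairs n" "(j', k') \<in> pairs n" "b > 1 \<or> n \<le> 4 \<or> (n = 5 \<and> i \<in> {2, 4})" for j k j' k'
    using lead_exp_neq_trail_exp[OF that(1,2) assms(2) that(3)] mono_divides_same_mdeg[of _ _ n]
      bidegree_lead_trail_exp(1,2) keys_lead_trail_exp that(1,2) by metis
  have basis: "groebner_basis n ?lt (I2Y b n) ?G" by (rule groebner_basis_GY[OF assms(2,4)])
  have "minimal_groebner_basis n ?lt (I2Y b n) ?G"
    unfolding minimal_groebner_basis_def using basis lead by (auto simp: G g)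
  moreover have "reduced_groebner_basis n ?lt (I2Y b n) ?G"
    if "b > 1 \<or> n \<le> 4 \<or> (n = 5 \<and> i \<in> {2, 4})"
    unfolding reduced_groebner_basis_def using basis lead trail[OF _ _ that] by (auto simp: G g)
  moreover have "card ?G = (n - 1) choose 2"
  proof -
    have "inj_on (\<lambda>(j, k). g j k) (pairs n)"
      using inject g(2) by (auto simp: inj_on_def) metis+
    then show ?thesis by (simp add: G card_image card_pairs)
  qed
  ultimately show ?thesis by blast
qed

end
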